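(* Let $S=S(G,\sigma)$ be a signed graph with underlying graph $G$ (finite, simple, undirected and connected). Then: (i) $imb_G(uv)\le imb_S^+(uv)+imb_S^-(uv)$ for every edge $uv\in E(S)=E(G)$; (ii) $irr(G)\le irr^+(S)+irr^-(S)$; (iii) $irr_t(G)\le irr_t^+(S)+irr_t^-(S)$.
   Context: All graphs are finite, simple, undirected and connected. A signed graph $S=S(G,\sigma)$ is a graph $G$ with vertex set $V(G)$ and edge set $E(G)$ together with a function $\sigma:E(G)\to\{+,-\}$; $G$ is its underlying graph, and $V(S)=V(G)$, $E(S)=E(G)$. For a vertex $v$, $d_G(v)$ is its degree in $G$, $d_S^+(v)$ is the number of positive edges incident with $v$, and $d_S^-(v)$ is the number of negative edges incident with $v$. For an edge $uv$: $imb_G(uv)=|d_G(u)-d_G(v)|$, $imb_S^+(uv)=|d_S^+(u)-d_S^+(v)|$, $imb_S^-(uv)=|d_S^-(u)-d_S^-(v)|$. Irregularities: $irr(G)=\sum_{uv\in E(G)}imb_G(uv)$, $irr^+(S)=\sum_{uv\in E(S)}imb_S^+(uv)$, $irr^-(S)=\sum_{uv\in E(S)}imb_S^-(uv)$. Total irregularities: $irr_t(G)=\frac12\sum_{u,v\in V(G)}|d_G(u)-d_G(v)|$, $irr_t^+(S)=\frac12\sum_{u,v\in V(S)}|d_S^+(u)-d_S^+(v)|$, $irr_t^-(S)=\frac12\sum_{u,v\in V(S)}|d_S^-(u)-d_S^-(v)|$, the sums being over all ordered pairs $(u,v)$ of vertices. *)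

theory Defs
  imports Complex_Main
begin

text \<open>
  A simple graph has a vertex set \<open>V\<close> and a set \<open>E\<close> of two-element subsets of \<open>V\<close>.
  The empty graph is not excluded.
\<close>

locale simple_graph =
  fixes V :: "'a set" and E :: "'a set set"
  assumes finite_verts: "finite V"
    and edge_wf: "e \<in> E \<Longrightarrow> e \<subseteq> V \<and> card e = 2"

locale connected_simple_graph = simple_graph +
  assumes connected: "u \<in> V \<Longrightarrow> v \<in> V \<Longrightarrow> (u, v) \<in> {(x, y). {x, y} \<in> E}\<^sup>*"

datatype sign = Pos | Neg

text \<open>
  A signed graph is a connected simple graph \<open>(V, E)\<close> with an arbitrary function
  \<open>\<sigma> :: 'a set \<Rightarrow> sign\<close>, of which only the values on \<open>E\<close> are ever used.
\<close>

definition deg :: "'a set set \<Rightarrow> 'a \<Rightarrow> nat" where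
  "deg E v = card {e \<in> E. v \<in> e}"

definition deg_pos :: "'a set set \<Rightarrow> ('a set \<Rightarrow> sign) \<Rightarrow> 'a \<Rightarrow> nat" where
  "deg_pos E \<sigma> v = card {e \<in> E. v \<in> e \<and> \<sigma> e = Pos}"

definition deg_neg :: "'a set set \<Rightarrow> ('a set \<Rightarrow> sign) \<Rightarrow> 'a \<Rightarrow> nat" where
  "deg_neg E \<sigma> v = card {e \<in> E. v \<in> e \<and> \<sigma> e = Neg}"

definition imb :: "'a set set \<Rightarrow> 'a \<Rightarrow> 'a \<Rightarrow> real" where
  "imb E u v = \<bar>real (deg E u) - real (deg E v)\<bar>"

definition imb_pos :: "'a set set \<Rightarrow> ('a set \<Rightarrow> sign) \<Rightarrow> 'a \<Rightarrow> 'a \<Rightarrow> real" where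
  "imb_pos E \<sigma> u v = \<bar>real (deg_pos E \<sigma> u) - real (deg_pos E \<sigma> v)\<bar>"

definition imb_neg :: "'a set set \<Rightarrow> ('a set \<Rightarrow> sign) \<Rightarrow> 'a \<Rightarrow> 'a \<Rightarrow> real" where
  "imb_neg E \<sigma> u v = \<bar>real (deg_neg E \<sigma> u) - real (deg_neg E \<sigma> v)\<bar>"

text \<open>
  The value \<open>f u v\<close> of a symmetric function at the unordered edge \<open>e = {u, v}\<close>.
  By \<open>on_edge_doubleton\<close> it does not depend on the order of the endpoints, so a sum of
  \<open>on_edge f e\<close> over \<open>e \<in> E\<close> counts each edge once.
\<close>

definition on_edge :: "('a \<Rightarrow> 'a \<Rightarrow> 'b) \<Rightarrow> 'a set \<Rightarrow> 'b" where
  "on_edge f e = (THE k. \<exists>u v. e = {u, v} \<and> k = f u v)"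

lemma on_edge_doubleton:
  assumes "\<And>x y. f x y = f y x"
  shows "on_edge f {u, v} = f u v"
  unfolding on_edge_def
proof (rule the_equality)
  show "\<exists>x y. {u, v} = {x, y} \<and> f u v = f x y"
    by blast
  fix k assume "\<exists>x y. {u, v} = {x, y} \<and> k = f x y"
  then show "k = f u v"
    using assms by (auto simp: doubleton_eq_iff)
qed

lemma on_edge_imb [simp]:
  "on_edge (imb E) {u, v} = imb E u v"
  "on_edge (imb_pos E \<sigma>) {u, v} = imb_pos E \<sigma> u v"
  "on_edge (imb_neg E \<sigma>) {u, v} = imb_neg E \<sigma> u v"
  by (rule on_edge_doubleton, simp add: imb_def imb_pos_def imb_neg_def abs_minus_commute)+

definition irr :: "'a set set \<Rightarrow> real" where
  "irr E = (\<Sum>e\<in>E. on_edge (imb E) e)"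

definition irr_pos :: "'a set set \<Rightarrow> ('a set \<Rightarrow> sign) \<Rightarrow> real" where
  "irr_pos E \<sigma> = (\<Sum>e\<in>E. on_edge (imb_pos E \<sigma>) e)"

definition irr_neg :: "'a set set \<Rightarrow> ('a set \<Rightarrow> sign) \<Rightarrow> real" where
  "irr_neg E \<sigma> = (\<Sum>e\<in>E. on_edge (imb_neg E \<sigma>) e)"

definition irr_total :: "'a set \<Rightarrow> 'a set set \<Rightarrow> real" where
  "irr_total V E = 1 / 2 * (\<Sum>(u, v)\<in>V \<times> V. \<bar>real (deg E u) - real (deg E v)\<bar>)"

definition irr_total_pos :: "'a set \<Rightarrow> 'a set set \<Rightarrow> ('a set \<Rightarrow> sign) \<Rightarrow> real" where
  "irr_total_pos V E \<sigma> =
    1 / 2 * (\<Sum>(u, v)\<in>V \<times> V. \<bar>real (deg_pos E \<sigma> u) - real (deg_pos E \<sigma> v)\<bar>)"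

definition irr_total_neg :: "'a set \<Rightarrow> 'a set set \<Rightarrow> ('a set \<Rightarrow> sign) \<Rightarrow> real" where
  "irr_total_neg V E \<sigma> =
    1 / 2 * (\<Sum>(u, v)\<in>V \<times> V. \<bar>real (deg_neg E \<sigma> u) - real (deg_neg E \<sigma> v)\<bar>)"

end

theory Submission
  imports Defs
begin

text \<open>
  Every edge at a vertex is either positive or negative, so the degree is the sum of the
  positive and the negative degree. Hence the degree difference of any two vertices, adjacent
  or not, is the sum of their two signed degree differences, and the triangle inequality for
  the absolute value bounds it pointwise (\<open>imb_le_imb_pos_plus_imb_neg\<close>). Summing this bound
  over the edges, and over all ordered pairs of vertices, gives the two inequalities between
  irregularities.
\<close>

lemma (in simple_graph) finite_edges: "finite E"
proof (rule finite_subset)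
  show "E \<subseteq> Pow V"
    using edge_wf by blast
  show "finite (Pow V)"
    using finite_verts by simp
qed

lemma deg_eq_deg_pos_plus_deg_neg:
  assumes "finite E"
  shows "deg E v = deg_pos E \<sigma> v + deg_neg E \<sigma> v"
proof -
  have "{e \<in> E. v \<in> e} = {e \<in> E. v \<in> e \<and> \<sigma> e = Pos} \<union> {e \<in> E. v \<in> e \<and> \<sigma> e = Neg}"
    using sign.exhaust by blast
  moreover have "{e \<in> E. v \<in> e \<and> \<sigma> e = Pos} \<inter> {e \<in> E. v \<in> e \<and> \<sigma> e = Neg} = {}"
    by auto
  ultimately show ?thesis
    using assms by (simp add: deg_def deg_pos_def deg_neg_def card_Un_disjoint)
qed

text \<open>
  This is the triangle inequality after splitting both degrees by sign. Ranging over arbitrary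
  pairs of vertices, it serves the sum over all pairs as well as the sum over edges.
\<close>

lemma imb_le_imb_pos_plus_imb_neg:
  assumes "finite E"
  shows "imb E u v \<le> imb_pos E \<sigma> u v + imb_neg E \<sigma> u v"
  using deg_eq_deg_pos_plus_deg_neg[OF assms, of u \<sigma>] deg_eq_deg_pos_plus_deg_neg[OF assms, of v \<sigma>]
  unfolding imb_def imb_pos_def imb_neg_def by linarith

lemma (in simple_graph) irr_le_irr_pos_plus_irr_neg: "irr E \<le> irr_pos E \<sigma> + irr_neg E \<sigma>"
proof -
  have "on_edge (imb E) e \<le> on_edge (imb_pos E \<sigma>) e + on_edge (imb_neg E \<sigma>) e"
    if "e \<in> E" for e
  proof -
    from edge_wf[OF that] obtain u v where "e = {u, v}"
      by (auto simp: card_2_iff)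
    then show ?thesis
      using imb_le_imb_pos_plus_imb_neg[OF finite_edges] by simp
  qed
  then show ?thesis
    unfolding irr_def irr_pos_def irr_neg_def sum.distrib[symmetric] by (rule sum_mono)
qed

lemma irr_total_le_irr_total_pos_plus_irr_total_neg:
  assumes "finite E"
  shows "irr_total V E \<le> irr_total_pos V E \<sigma> + irr_total_neg V E \<sigma>"
proof -
  have "(\<Sum>(u, v)\<in>V \<times> V. imb E u v)
      \<le> (\<Sum>(u, v)\<in>V \<times> V. imb_pos E \<sigma> u v) + (\<Sum>(u, v)\<in>V \<times> V. imb_neg E \<sigma> u v)"
    unfolding sum.distrib[symmetric]
    by (rule sum_mono) (auto intro: imb_le_imb_pos_plus_imb_neg[OF assms])
  then show ?thesis
    unfolding irr_total_def irr_total_pos_def irr_total_neg_def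
      imb_def imb_pos_def imb_neg_def by linarith
qed

theorem theorem2:
  fixes V :: "'a set" and E :: "'a set set" and \<sigma> :: "'a set \<Rightarrow> sign"
  assumes "connected_simple_graph V E"
  shows "(\<forall>u v. {u, v} \<in> E \<longrightarrow> imb E u v \<le> imb_pos E \<sigma> u v + imb_neg E \<sigma> u v) \<and>
    irr E \<le> irr_pos E \<sigma> + irr_neg E \<sigma> \<and>
    irr_total V E \<le> irr_total_pos V E \<sigma> + irr_total_neg V E \<sigma>"
proof -
  interpret connected_simple_graph V E
    by (rule assms)
  show ?thesis
    using imb_le_imb_pos_plus_imb_neg[OF finite_edges] irr_le_irr_pos_plus_irr_neg
      irr_total_le_irr_total_pos_plus_irr_total_neg[OF finite_edges] by blast
qed

end
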